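(* Let $0<\theta\le 1$, $0\le\mu\le 1$, $\tau>0$, and let $(u^n)_{n\ge 0}$ be the sequence generated by the $(\theta,\mu)$-method with constant step size $\tau$ and initial value $u^0$ (described in the context). Then for all $m\ge 2$ the following energy identity holds: $$\frac12\|\nabla u^m\|^2+\tau\sum_{n=1}^m\|d_tu^n\|_\star^2+\frac{\tau^2}{2}\|\nabla d_tu^1\|^2+\Big(\theta-\frac12\Big)\tau^2\sum_{n=2}^m\|\nabla d_tu^n\|^2=\frac12\|\nabla u^0\|^2 .$$
   Context: Setting. $\Omega\subset\mathbb{R}^d$ is a bounded domain with Lipschitz boundary, $\Gamma_D\subset\partial\Omega$ has positive surface measure, and $u_D:\Gamma_D\to\mathbb{R}^\ell$ is the trace of some $\tilde u_D\in H^1(\Omega;\mathbb{R}^\ell)$ with $|\tilde u_D|=1$ a.e. in $\Omega$. $H^1_D(\Omega;\mathbb{R}^\ell)$ is the subspace of $H^1(\Omega;\mathbb{R}^\ell)$ of functions with vanishing trace on $\Gamma_D$. $(\cdot,\cdot)$ and $\|\cdot\|$ are the $L^2(\Omega)$ inner product and norm; $|\cdot|$ is the Euclidean length and $\cdot$ between vectors the Euclidean inner product in $\mathbb{R}^\ell$ (applied pointwise to vector fields). $(\cdot,\cdot)_\star$ is either the $L^2$-inner product $(\cdot,\cdot)$ or the $H^1$-inner product $(\nabla\cdot,\nabla\cdot)$ on $H^1_D(\Omega;\mathbb{R}^\ell)$, with induced norm $\|\cdot\|_\star$. There is a constant $c_\star>0$ with $\|v\|\le c_\star^{1/2}\|v\|_\star$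 for all $v\in H^1_D(\Omega;\mathbb{R}^\ell)$. The $(\theta,\mu)$-method with constant step size $\tau>0$. Write $d_tu^n:=(u^n-u^{n-1})/\tau$ for $n\ge1$. Choose $u^0\in H^1(\Omega;\mathbb{R}^\ell)$ with $u^0|_{\Gamma_D}=u_D$ and $|u^0|=1$ a.e. in $\Omega$. Step 1 (implicit Euler): $d_tu^1\in H^1_D(\Omega;\mathbb{R}^\ell)$ satisfies $d_tu^1\cdot u^0=0$ a.e. in $\Omega$ and $(d_tu^1,v)_\star+(\nabla[u^0+\tau d_tu^1],\nabla v)=0$ for all $v\in H^1_D(\Omega;\mathbb{R}^\ell)$ with $v\cdot u^0=0$ a.e.; set $u^1=u^0+\tau d_tu^1$. Step $n\ge2$: set $\widehat u^{\,n-1+\mu}:=u^{n-1}+\mu\tau d_tu^{n-1}$; $d_tu^n\in H^1_D(\Omega;\mathbb{R}^\ell)$ satisfies $d_tu^n\cdot\widehat u^{\,n-1+\mu}=0$ a.e. in $\Omega$ and $(d_tu^n,v)_\star+(\nabla[u^{n-1}+\theta\tau d_tu^n],\nabla v)=0$ for all $v\in H^1_D(\Omega;\mathbb{R}^\ell)$ with $v\cdot\widehat u^{\,n-1+\mu}=0$ a.e.; set $u^n=u^{n-1}+\tau d_tu^n$. (In the algorithm a stopping test may truncate the sequence; it plays no other role, so the iteration is regarded as continued for all $n$.) *)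

theory Defs
  imports "HOL-Analysis.Analysis"
begin

section \<open>Surface measure\<close>

text \<open>Normalised Hausdorff measure of integer dimension \<open>k\<close>.  The empty set is given weight zero
  explicitly because \<open>0 ^ 0 = 1\<close>, so that dimension zero yields the counting measure.\<close>

definition hausdorff_weight :: "nat \<Rightarrow> 'a::metric_space set \<Rightarrow> ennreal" where
  "hausdorff_weight k C =
     (if C = {} then 0 else ennreal (unit_ball_vol (real k) * (diameter C / 2) ^ k))"

definition hausdorff_covers :: "real \<Rightarrow> 'a::metric_space set \<Rightarrow> (nat \<Rightarrow> 'a set) set" where
  "hausdorff_covers \<delta> A =
     {C. A \<subseteq> (\<Union>i. C i) \<and> (\<forall>i. bounded (C i) \<and> diameter (C i) \<le> \<delta>)}"

definition hausdorff_outer :: "nat \<Rightarrow> 'a::metric_space set \<Rightarrow> ennreal" where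
  "hausdorff_outer k A =
     (SUP \<delta>\<in>{0<..}. INF C\<in>hausdorff_covers \<delta> A. \<Sum>i. hausdorff_weight k (C i))"

definition hausdorff_measure :: "nat \<Rightarrow> 'a::metric_space measure" where
  "hausdorff_measure k =
     measure_of UNIV (lambda_system UNIV UNIV (hausdorff_outer k)) (hausdorff_outer k)"

lemma hausdorff_covers_mono: "A \<subseteq> B \<Longrightarrow> hausdorff_covers \<delta> B \<subseteq> hausdorff_covers \<delta> A"
  by (auto simp: hausdorff_covers_def)

lemma countably_subadditive_hausdorff_premeasure:
  fixes A :: "nat \<Rightarrow> 'a::metric_space set"
  shows "(INF C\<in>hausdorff_covers \<delta> (\<Union>i. A i). \<Sum>i. hausdorff_weight k (C i))
       \<le> (\<Sum>i. INF C\<in>hausdorff_covers \<delta> (A i). \<Sum>j. hausdorff_weight k (C j))"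
    (is "?H (\<Union>i. A i) \<le> (\<Sum>i. ?H (A i))")
proof (rule ennreal_le_epsilon)
  fix e :: real
  assume fin: "(\<Sum>i. ?H (A i)) < top" and "0 < e"
  have "\<exists>C\<in>hausdorff_covers \<delta> (A i).
          (\<Sum>j. hausdorff_weight k (C j)) \<le> ?H (A i) + ennreal (e * (1/2) ^ Suc i)" for i
  proof -
    have less: "x < x + ennreal r" if "x < top" "0 < r" for x r
      using that by (auto simp: less_top)
    have "?H (A i) < top"
      using fin by (rule ennreal_suminf_lessD)
    then have "?H (A i) < ?H (A i) + ennreal (e * (1/2) ^ Suc i)"
      using \<open>0 < e\<close> by (intro less) simp_all
    then show ?thesis
      by (subst (asm) INF_less_iff) (blast intro: less_imp_le)
  qed
  then obtain C where C: "\<And>i. C i \<in> hausdorff_covers \<delta> (A i)"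
    and Cle: "\<And>i. (\<Sum>j. hausdorff_weight k (C i j)) \<le> ?H (A i) + ennreal (e * (1/2) ^ Suc i)"
    by metis
  define D where "D = (\<lambda>n. case_prod C (prod_decode n))"
  have "D \<in> hausdorff_covers \<delta> (\<Union>i. A i)"
    unfolding hausdorff_covers_def
  proof (intro CollectI conjI allI subsetI)
    fix x assume "x \<in> (\<Union>i. A i)"
    then obtain i j where "x \<in> C i j"
      using C unfolding hausdorff_covers_def by blast
    then have "x \<in> D (prod_encode (i, j))"
      by (simp add: D_def)
    then show "x \<in> (\<Union>i. D i)" by blast
  next
    fix n
    show "bounded (D n)" "diameter (D n) \<le> \<delta>"
      using C by (auto simp: D_def hausdorff_covers_def split: prod.split)
  qed
  then have "?H (\<Union>i. A i) \<le> (\<Sum>n. hausdorff_weight k (D n))"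
    by (rule INF_lower)
  also have "\<dots> = (\<Sum>i. \<Sum>j. hausdorff_weight k (C i j))"
    using suminf_ennreal_2dimen[of "\<lambda>i. \<Sum>j. hausdorff_weight k (C i j)"
            "\<lambda>(i, j). hausdorff_weight k (C i j)"]
    by (simp add: D_def comp_def case_prod_beta)
  also have "\<dots> \<le> (\<Sum>i. ?H (A i) + ennreal (e * (1/2) ^ Suc i))"
    by (intro suminf_le Cle) auto
  also have "\<dots> = (\<Sum>i. ?H (A i)) + (\<Sum>i. ennreal (e * (1/2) ^ Suc i))"
    by (subst suminf_add) auto
  also have "(\<Sum>i. ennreal (e * (1/2) ^ Suc i)) = ennreal e"
    using \<open>0 < e\<close> sums_mult[OF power_half_series, of e]
    by (subst suminf_ennreal_eq[where x=e]) auto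
  finally show "?H (\<Union>i. A i) \<le> (\<Sum>i. ?H (A i)) + ennreal e" .
qed

lemma outer_measure_space_hausdorff:
  "outer_measure_space UNIV (hausdorff_outer k :: 'a::metric_space set \<Rightarrow> ennreal)"
  unfolding outer_measure_space_def
proof (intro conjI)
  have "(INF C\<in>hausdorff_covers \<delta> ({} :: 'a set). \<Sum>i. hausdorff_weight k (C i)) = 0" if "0 < \<delta>" for \<delta>
  proof -
    have "(\<lambda>_. {}) \<in> hausdorff_covers \<delta> ({} :: 'a set)"
      using that by (simp add: hausdorff_covers_def)
    then have "(INF C\<in>hausdorff_covers \<delta> ({} :: 'a set). \<Sum>i. hausdorff_weight k (C i))
        \<le> (\<Sum>i::nat. hausdorff_weight k ({} :: 'a set))"
      by (rule INF_lower2) simp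
    then show ?thesis by (simp add: hausdorff_weight_def)
  qed
  then have "(SUP \<delta>\<in>{0<..}. INF C\<in>hausdorff_covers \<delta> ({} :: 'a set).
      \<Sum>i. hausdorff_weight k (C i)) \<le> 0"
    by (intro SUP_least) simp
  then show "positive UNIV (hausdorff_outer k :: 'a set \<Rightarrow> ennreal)"
    unfolding positive_def hausdorff_outer_def by (metis le_zero_eq)
  show "increasing UNIV (hausdorff_outer k :: 'a set \<Rightarrow> ennreal)"
    unfolding increasing_def hausdorff_outer_def
    by (auto intro!: SUP_mono' INF_superset_mono hausdorff_covers_mono)
  show "countably_subadditive UNIV (hausdorff_outer k :: 'a set \<Rightarrow> ennreal)"
    unfolding countably_subadditive_def
  proof (intro allI impI)
    fix A :: "nat \<Rightarrow> 'a set"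
    show "hausdorff_outer k (\<Union>i. A i) \<le> (\<Sum>i. hausdorff_outer k (A i))"
      unfolding hausdorff_outer_def[of k "\<Union>i. A i"]
    proof (rule SUP_least)
      fix \<delta> :: real assume "\<delta> \<in> {0<..}"
      then have "(\<Sum>i. INF C\<in>hausdorff_covers \<delta> (A i). \<Sum>j. hausdorff_weight k (C j))
          \<le> (\<Sum>i. hausdorff_outer k (A i))"
        unfolding hausdorff_outer_def by (intro suminf_le SUP_upper) auto
      then show "(INF C\<in>hausdorff_covers \<delta> (\<Union>i. A i). \<Sum>i. hausdorff_weight k (C i))
          \<le> (\<Sum>i. hausdorff_outer k (A i))"
        using countably_subadditive_hausdorff_premeasure order_trans by blast
    qed
  qed
qed

lemma measure_space_hausdorff:
  "measure_space UNIV (lambda_system UNIV UNIV (hausdorff_outer k)) (hausdorff_outer k)"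
  by (rule sigma_algebra.caratheodory_lemma[OF sigma_algebra_Pow[of UNIV, unfolded Pow_UNIV]
        outer_measure_space_hausdorff])

lemma space_hausdorff_measure [simp]: "space (hausdorff_measure k) = UNIV"
  by (simp add: hausdorff_measure_def)

lemma sets_hausdorff_measure:
  "sets (hausdorff_measure k) = lambda_system UNIV UNIV (hausdorff_outer k)"
proof -
  have "sigma_algebra UNIV (lambda_system UNIV UNIV (hausdorff_outer k :: 'a set \<Rightarrow> ennreal))"
    using measure_space_hausdorff by (auto simp: measure_space_def)
  then show ?thesis
    unfolding hausdorff_measure_def by (rule sigma_algebra.sets_measure_of_eq)
qed

lemma emeasure_hausdorff_measure:
  assumes "A \<in> sets (hausdorff_measure k)"
  shows "emeasure (hausdorff_measure k) A = hausdorff_outer k A"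
  unfolding hausdorff_measure_def
  using assms measure_space_hausdorff[of k]
  by (intro emeasure_measure_of_sigma) (auto simp: measure_space_def sets_hausdorff_measure)

definition surface_measure :: "(real^'d) set \<Rightarrow> (real^'d) measure" where
  "surface_measure \<Omega> = restrict_space (hausdorff_measure (CARD('d) - 1)) (frontier \<Omega>)"


section \<open>Bounded Lipschitz domains\<close>

text \<open>In a neighbourhood \<open>U\<close> of each boundary point, \<open>\<Omega>\<close> is the strict epigraph, in direction of
  a unit vector \<open>e\<close>, of a Lipschitz function \<open>\<gamma>\<close> on the hyperplane orthogonal to \<open>e\<close>.\<close>

definition lipschitz_boundary :: "(real^'d) set \<Rightarrow> bool" where
  "lipschitz_boundary \<Omega> \<longleftrightarrow>
     (\<forall>p\<in>frontier \<Omega>. \<exists>U e \<gamma> L.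
        open U \<and> p \<in> U \<and> norm e = 1 \<and> L-lipschitz_on {y. y \<bullet> e = 0} \<gamma> \<and>
        \<Omega> \<inter> U = {x \<in> U. \<gamma> (x - (x \<bullet> e) *\<^sub>R e) < x \<bullet> e})"

definition bounded_lipschitz_domain :: "(real^'d) set \<Rightarrow> bool" where
  "bounded_lipschitz_domain \<Omega> \<longleftrightarrow>
     \<Omega> \<noteq> {} \<and> open \<Omega> \<and> connected \<Omega> \<and> bounded \<Omega> \<and> lipschitz_boundary \<Omega>"


section \<open>Square-integrable functions\<close>

text \<open>Functions are representatives, not equivalence classes modulo null sets.\<close>

definition L2 :: "'a measure \<Rightarrow> ('a \<Rightarrow> 'b::euclidean_space) set" where
  "L2 M = {f. f \<in> borel_measurable M \<and> integrable M (\<lambda>x. (norm (f x))\<^sup>2)}"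

definition L2_ip :: "'a measure \<Rightarrow> ('a \<Rightarrow> 'b::euclidean_space) \<Rightarrow> ('a \<Rightarrow> 'b) \<Rightarrow> real" where
  "L2_ip M f g = (LINT x|M. f x \<bullet> g x)"

definition induced_norm :: "('f \<Rightarrow> 'f \<Rightarrow> real) \<Rightarrow> 'f \<Rightarrow> real" where
  "induced_norm ip f = sqrt (ip f f)"

abbreviation L2_norm :: "'a measure \<Rightarrow> ('a \<Rightarrow> 'b::euclidean_space) \<Rightarrow> real" where
  "L2_norm M \<equiv> induced_norm (L2_ip M)"


section \<open>Weak gradients and Sobolev spaces\<close>

definition partial_deriv :: "'d \<Rightarrow> (real^'d \<Rightarrow> 'b::real_normed_vector) \<Rightarrow> real^'d \<Rightarrow> 'b" where
  "partial_deriv j f x = frechet_derivative f (at x) (axis j 1)"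

primrec C_diff :: "nat \<Rightarrow> (real^'d \<Rightarrow> 'b::real_normed_vector) \<Rightarrow> bool" where
  "C_diff 0 f \<longleftrightarrow> continuous_on UNIV f"
| "C_diff (Suc k) f \<longleftrightarrow>
     (\<forall>x. f differentiable (at x)) \<and> (\<forall>j. C_diff k (partial_deriv j f))"

definition smooth :: "(real^'d \<Rightarrow> 'b::real_normed_vector) \<Rightarrow> bool" where
  "smooth f \<longleftrightarrow> (\<forall>k. C_diff k f)"

definition test_functions :: "(real^'d) set \<Rightarrow> (real^'d \<Rightarrow> real) set" where
  "test_functions \<Omega> =
     {\<phi>. smooth \<phi> \<and> compact (closure {x. \<phi> x \<noteq> 0}) \<and> closure {x. \<phi> x \<noteq> 0} \<subseteq> \<Omega>}"

definition locally_integrable :: "(real^'d) set \<Rightarrow> (real^'d \<Rightarrow> 'b::euclidean_space) \<Rightarrow> bool" where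
  "locally_integrable \<Omega> f \<longleftrightarrow> (\<forall>K. compact K \<and> K \<subseteq> \<Omega> \<longrightarrow> f absolutely_integrable_on K)"

text \<open>The entry \<open>G x $ i $ j\<close> is the \<open>j\<close>-th weak partial derivative of the \<open>i\<close>-th component of \<open>u\<close>,
  so that the inner product of the type \<open>real^'d^'l\<close> is the Frobenius inner product of gradients.\<close>

definition has_weak_gradient ::
  "(real^'d) set \<Rightarrow> (real^'d \<Rightarrow> real^'l) \<Rightarrow> (real^'d \<Rightarrow> real^'d^'l) \<Rightarrow> bool" where
  "has_weak_gradient \<Omega> u G \<longleftrightarrow>
     locally_integrable \<Omega> u \<and> locally_integrable \<Omega> G \<and>
     (\<forall>\<phi>\<in>test_functions \<Omega>. \<forall>i j.
        (LINT x|lebesgue_on \<Omega>. u x $ i * partial_deriv j \<phi> x) =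
        - (LINT x|lebesgue_on \<Omega>. G x $ i $ j * \<phi> x))"

text \<open>A representative; weak gradients on open sets are unique up to null sets.\<close>

definition weak_grad :: "(real^'d) set \<Rightarrow> (real^'d \<Rightarrow> real^'l) \<Rightarrow> real^'d \<Rightarrow> real^'d^'l" where
  "weak_grad \<Omega> u = (SOME G. has_weak_gradient \<Omega> u G)"

definition H1 :: "(real^'d) set \<Rightarrow> (real^'d \<Rightarrow> real^'l) set" where
  "H1 \<Omega> = {u \<in> L2 (lebesgue_on \<Omega>). \<exists>G \<in> L2 (lebesgue_on \<Omega>). has_weak_gradient \<Omega> u G}"

definition grad_ip ::
  "(real^'d) set \<Rightarrow> (real^'d \<Rightarrow> real^'l) \<Rightarrow> (real^'d \<Rightarrow> real^'l) \<Rightarrow> real" where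
  "grad_ip \<Omega> u v = L2_ip (lebesgue_on \<Omega>) (weak_grad \<Omega> u) (weak_grad \<Omega> v)"


section \<open>Traces\<close>

text \<open>The trace operator is the continuous extension to \<open>H1 \<Omega>\<close>, with values in \<open>L2\<close> of the boundary,
  of the restriction map \<open>\<phi> \<mapsto> \<phi>|frontier \<Omega>\<close> on functions that are smooth up to the boundary (these
  are dense for Lipschitz boundaries).  The relation below is the graph of this extension.\<close>

definition has_trace ::
  "(real^'d) set \<Rightarrow> (real^'d \<Rightarrow> real^'l) \<Rightarrow> (real^'d \<Rightarrow> real^'l) \<Rightarrow> bool" where
  "has_trace \<Omega> u g \<longleftrightarrow>
     u \<in> H1 \<Omega> \<and> g \<in> L2 (surface_measure \<Omega>) \<and>
     (\<exists>\<phi>. (\<forall>k. smooth (\<phi> k)) \<and>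
        (\<lambda>k. L2_norm (lebesgue_on \<Omega>) (\<lambda>x. \<phi> k x - u x)) \<longlonglongrightarrow> 0 \<and>
        (\<lambda>k. induced_norm (grad_ip \<Omega>) (\<lambda>x. \<phi> k x - u x)) \<longlonglongrightarrow> 0 \<and>
        (\<lambda>k. L2_norm (surface_measure \<Omega>) (\<lambda>x. \<phi> k x - g x)) \<longlonglongrightarrow> 0)"

definition has_trace_on ::
  "(real^'d) set \<Rightarrow> (real^'d) set \<Rightarrow> (real^'d \<Rightarrow> real^'l) \<Rightarrow> (real^'d \<Rightarrow> real^'l) \<Rightarrow> bool" where
  "has_trace_on \<Omega> \<Gamma> u h \<longleftrightarrow>
     (\<exists>g. has_trace \<Omega> u g \<and> (AE x in surface_measure \<Omega>. x \<in> \<Gamma> \<longrightarrow> g x = h x))"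

definition H1D :: "(real^'d) set \<Rightarrow> (real^'d) set \<Rightarrow> (real^'d \<Rightarrow> real^'l) set" where
  "H1D \<Omega> \<Gamma> = {v \<in> H1 \<Omega>. has_trace_on \<Omega> \<Gamma> v (\<lambda>x. 0)}"


section \<open>The \<open>(\<theta>, \<mu>)\<close>-method\<close>

definition diff_quot ::
  "real \<Rightarrow> (nat \<Rightarrow> real^'d \<Rightarrow> real^'l) \<Rightarrow> nat \<Rightarrow> real^'d \<Rightarrow> real^'l" where
  "diff_quot \<tau> u n = (\<lambda>x. (1 / \<tau>) *\<^sub>R (u n x - u (n - 1) x))"

definition constrained_step ::
  "(real^'d) set \<Rightarrow> (real^'d) set \<Rightarrow>
   ((real^'d \<Rightarrow> real^'l) \<Rightarrow> (real^'d \<Rightarrow> real^'l) \<Rightarrow> real) \<Rightarrow>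
   real \<Rightarrow> (real^'d \<Rightarrow> real^'l) \<Rightarrow> (real^'d \<Rightarrow> real^'l) \<Rightarrow> (real^'d \<Rightarrow> real^'l) \<Rightarrow> bool" where
  "constrained_step \<Omega> \<Gamma>\<^sub>D star s w u d \<longleftrightarrow>
     d \<in> H1D \<Omega> \<Gamma>\<^sub>D \<and>
     (AE x in lebesgue_on \<Omega>. d x \<bullet> w x = 0) \<and>
     (\<forall>v\<in>H1D \<Omega> \<Gamma>\<^sub>D. (AE x in lebesgue_on \<Omega>. v x \<bullet> w x = 0) \<longrightarrow>
        star d v + grad_ip \<Omega> (\<lambda>x. u x + s *\<^sub>R d x) v = 0)"

text \<open>The update \<open>u\<^sup>n = u\<^sup>n\<^sup>-\<^sup>1 + \<tau> d\<^sub>tu\<^sup>n\<close> is implicit in taking \<open>d\<^sub>tu\<^sup>n\<close> to be the difference quotient of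
  the sequence.\<close>

definition theta_mu_sequence ::
  "(real^'d) set \<Rightarrow> (real^'d) set \<Rightarrow> (real^'d \<Rightarrow> real^'l) \<Rightarrow>
   ((real^'d \<Rightarrow> real^'l) \<Rightarrow> (real^'d \<Rightarrow> real^'l) \<Rightarrow> real) \<Rightarrow>
   real \<Rightarrow> real \<Rightarrow> real \<Rightarrow> (nat \<Rightarrow> real^'d \<Rightarrow> real^'l) \<Rightarrow> bool" where
  "theta_mu_sequence \<Omega> \<Gamma>\<^sub>D u\<^sub>D star \<theta> \<mu> \<tau> u \<longleftrightarrow>
     u 0 \<in> H1 \<Omega> \<and> has_trace_on \<Omega> \<Gamma>\<^sub>D (u 0) u\<^sub>D \<and> (AE x in lebesgue_on \<Omega>. norm (u 0 x) = 1) \<and>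
     constrained_step \<Omega> \<Gamma>\<^sub>D star \<tau> (u 0) (u 0) (diff_quot \<tau> u 1) \<and>
     (\<forall>n\<ge>2. constrained_step \<Omega> \<Gamma>\<^sub>D star (\<theta> * \<tau>)
        (\<lambda>x. u (n - 1) x + (\<mu> * \<tau>) *\<^sub>R diff_quot \<tau> u (n - 1) x)
        (u (n - 1)) (diff_quot \<tau> u n))"

end

theory Submission
  imports Defs
begin

text \<open>Testing each step with \<open>v = d\<^sub>tu\<^sup>n\<close> itself gives
  \<open>\<parallel>d\<^sub>tu\<^sup>n\<parallel>\<^sub>\<star>\<^sup>2 + (\<nabla>u\<^sup>n\<^sup>-\<^sup>1, \<nabla>d\<^sub>tu\<^sup>n) + s \<parallel>\<nabla>d\<^sub>tu\<^sup>n\<parallel>\<^sup>2 = 0\<close>, where \<open>s = \<tau>\<close>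
  for \<open>n = 1\<close> and \<open>s = \<theta> \<tau>\<close> afterwards, and expanding \<open>\<parallel>\<nabla>(u\<^sup>n\<^sup>-\<^sup>1 + \<tau> d\<^sub>tu\<^sup>n)\<parallel>\<^sup>2\<close> turns
  this into an energy balance whose sum over \<open>n\<close> telescopes.  Since \<open>weak_grad\<close> is an arbitrary
  choice of a weak gradient, its linearity (almost everywhere) rests on the uniqueness of weak
  gradients, that is, on the fundamental lemma of the calculus of variations.\<close>


section \<open>Smooth bump functions on boxes\<close>

lemma partial_deriv_eq:
  assumes "(f has_derivative f') (at x)"
  shows "partial_deriv j f x = f' (axis j 1)"
  using frechet_derivative_at[OF assms] by (simp add: partial_deriv_def)

lemma C_diff_const: "C_diff k (\<lambda>x::real^'d. c)"
proof (induction k arbitrary: c)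
  case (Suc k)
  have "partial_deriv j (\<lambda>x::real^'d. c) = (\<lambda>x. 0)" for j
    by (intro ext) (rule partial_deriv_eq[OF has_derivative_const])
  then show ?case using Suc by simp
qed simp

text \<open>Differentiability gives continuity at the lowest order. Lowering the order is needed for
  the product rule, whose summands keep one factor undifferentiated.\<close>

lemma C_diff_SucD: "C_diff (Suc k) f \<Longrightarrow> C_diff k f"
proof (induction k arbitrary: f)
  case 0
  then show ?case
    by (auto intro!: continuous_at_imp_continuous_on differentiable_imp_continuous_within)
qed simp

lemma C_diff_imp_continuous_on: "C_diff k f \<Longrightarrow> continuous_on UNIV f"
  by (induction k) (auto dest: C_diff_SucD simp del: C_diff.simps(2))

lemma C_diff_add:
  assumes "C_diff k f" "C_diff k g"
  shows "C_diff k (\<lambda>x. f x + g x)"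
  using assms
proof (induction k arbitrary: f g)
  case (Suc k)
  have "partial_deriv j (\<lambda>x. f x + g x) = (\<lambda>x. partial_deriv j f x + partial_deriv j g x)" for j
    using Suc.prems
    by (intro ext, subst partial_deriv_eq[OF has_derivative_add])
       (auto simp: frechet_derivative_works partial_deriv_def)
  then show ?case using Suc by simp
qed (simp add: continuous_on_add)

lemma C_diff_mult:
  fixes f g :: "real^'d \<Rightarrow> real"
  assumes "C_diff k f" "C_diff k g"
  shows "C_diff k (\<lambda>x. f x * g x)"
  using assms
proof (induction k arbitrary: f g)
  case (Suc k)
  have "partial_deriv j (\<lambda>x. f x * g x)
      = (\<lambda>x. f x * partial_deriv j g x + partial_deriv j f x * g x)" for j
    using Suc.prems
    by (intro ext, subst partial_deriv_eq[OF has_derivative_mult])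
       (auto simp: frechet_derivative_works partial_deriv_def)
  then show ?case
    using Suc C_diff_SucD[OF Suc.prems(1)] C_diff_SucD[OF Suc.prems(2)]
    by (simp add: C_diff_add)
qed (simp add: continuous_on_mult)

lemma C_diff_prod:
  fixes f :: "'i \<Rightarrow> real^'d \<Rightarrow> real"
  assumes "\<And>i. i \<in> I \<Longrightarrow> C_diff k (f i)"
  shows "C_diff k (\<lambda>x. \<Prod>i\<in>I. f i x)"
  using assms
  by (induction I rule: infinite_finite_induct) (auto intro: C_diff_mult C_diff_const)

section \<open>The function exp(-1/t), extended by zero to \<open>t\<close> \<le> 0, and its
  derivatives\<close>

text \<open>The polynomial factor makes this class of functions closed under differentiation.\<close>

definition flat :: "real poly \<Rightarrow> real \<Rightarrow> real" where
  "flat p t = (if t > 0 then poly p (1 / t) * exp (- (1 / t)) else 0)"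

text \<open>The exponential beats each monomial separately. Substituting 1/h for the argument yields
  the decay of \<open>flat p\<close> at the origin.\<close>

lemma poly_times_exp_minus_tendsto_0: "((\<lambda>x::real. poly p x * exp (- x)) \<longlongrightarrow> 0) at_top"
proof -
  have "((\<lambda>x::real. \<Sum>i\<le>degree p. coeff p i * (x ^ i / exp x)) \<longlongrightarrow> (\<Sum>i\<le>degree p. coeff p i * 0)) at_top"
    by (intro tendsto_intros tendsto_power_div_exp_0)
  then show ?thesis
    by (simp add: poly_altdef sum_distrib_right exp_minus divide_inverse mult.assoc)
qed

text \<open>With s = 1/t, the chain rule gives s^2 (p(s) - p'(s)) exp(-s) for \<open>t\<close> > 0,
  and \<open>[:0, 0, 1:]\<close> is the factor s^2. For \<open>t\<close> < 0 everything vanishes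
  locally; at the origin the two one-sided difference quotients are treated separately.\<close>

lemma flat_has_real_derivative:
  "(flat p has_real_derivative flat ([:0, 0, 1:] * (p - pderiv p)) t) (at t)"
proof -
  consider "t > 0" | "t < 0" | "t = 0" by linarith
  then show ?thesis
  proof cases
    case 1
    have "((\<lambda>t. poly p (1 / t) * exp (- (1 / t))) has_real_derivative
        flat ([:0, 0, 1:] * (p - pderiv p)) t) (at t)"
      using 1 by (auto intro!: derivative_eq_intros poly_DERIV[THEN DERIV_chain2]
                       simp: flat_def field_simps power2_eq_square)
    then show ?thesis
      by (rule has_field_derivative_transform_within_open[where S="{0<..}"])
         (use 1 in \<open>auto simp: flat_def\<close>)
  next
    case 2
    have "((\<lambda>_. 0) has_real_derivative flat ([:0, 0, 1:] * (p - pderiv p)) t) (at t)"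
      using 2 by (simp add: flat_def)
    then show ?thesis
      by (rule has_field_derivative_transform_within_open[where S="{..<0}"])
         (use 2 in \<open>auto simp: flat_def\<close>)
  next
    case 3
    have "((\<lambda>h. flat p h / h) \<longlongrightarrow> 0) (at_left 0)"
      by (rule tendsto_eventually) (auto simp: flat_def eventually_at_filter)
    moreover have "((\<lambda>h. flat p h / h) \<longlongrightarrow> 0) (at_right 0)"
    proof -
      \<comment> \<open>\<open>pCons 0 p\<close> multiplies \<open>p\<close> by its argument, here
        1/h, and so absorbs the denominator of the difference quotient.\<close>
      have "((\<lambda>h. poly (pCons 0 p) (inverse h) * exp (- inverse h)) \<longlongrightarrow> 0) (at_right (0::real))"
        by (rule filterlim_compose[OF poly_times_exp_minus_tendsto_0 filterlim_inverse_at_top_right])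
      then show ?thesis
        by (rule Lim_transform_eventually)
           (auto simp: flat_def eventually_at_filter field_simps)
    qed
    ultimately have "((\<lambda>h. flat p h / h) \<longlongrightarrow> 0) (at 0)"
      by (simp add: filterlim_split_at)
    then show ?thesis
      using 3 by (simp add: DERIV_def flat_def)
  qed
qed

text \<open>Induction over \<open>k\<close> for all \<open>p\<close> at once: each partial
  derivative is a constant times a function of the same shape with another polynomial. The slope
  \<open>c\<close> may be negative, which serves the upper faces of a box.\<close>

lemma C_diff_flat_affine:
  "C_diff k (\<lambda>x::real^'d. flat p (c * x $ i + b))"
proof (induction k arbitrary: p)
  case 0
  have "continuous_on UNIV (flat p)"
    by (meson DERIV_isCont continuous_at_imp_continuous_on flat_has_real_derivative)
  then show ?case
    by (auto intro!: continuous_on_compose2[of UNIV "flat p"] continuous_intros)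
next
  case (Suc k)
  let ?p' = "[:0, 0, 1:] * (p - pderiv p)"
  have deriv: "((\<lambda>x::real^'d. flat p (c * x $ i + b)) has_derivative
      (\<lambda>v. c * v $ i * flat ?p' (c * x $ i + b))) (at x)" for x
  proof -
    have "((\<lambda>x::real^'d. c * x $ i + b) has_derivative (\<lambda>v. c * v $ i)) (at x)"
      by (auto intro!: derivative_eq_intros bounded_linear_imp_has_derivative bounded_linear_vec_nth)
    from has_derivative_compose[OF this flat_has_real_derivative[unfolded has_field_derivative_def]]
    show ?thesis
      by (simp add: mult_ac)
  qed
  have "partial_deriv j (\<lambda>x::real^'d. flat p (c * x $ i + b))
      = (\<lambda>x. c * axis j 1 $ i * flat ?p' (c * x $ i + b))" for j
    using partial_deriv_eq[OF deriv] by auto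
  then show ?case
    using deriv by (auto simp: differentiable_def simp del: mult_pCons_left
        intro!: C_diff_mult[OF C_diff_const Suc])
qed

text \<open>Since \<open>flat 1 t\<close> is exp(-1/t) for positive \<open>t\<close> and tends to 1
  as \<open>t\<close> grows, large \<open>r\<close> pushes the bump up to 1 inside the box while its
  zero set stays fixed.\<close>

definition box_bump :: "real^'d \<Rightarrow> real^'d \<Rightarrow> real \<Rightarrow> real^'d \<Rightarrow> real" where
  "box_bump a b r x = (\<Prod>i\<in>UNIV. flat 1 (r * (x $ i - a $ i)) * flat 1 (r * (b $ i - x $ i)))"

lemma flat_1_bounds: "0 \<le> flat 1 t" "flat 1 t \<le> 1"
  by (auto simp: flat_def)

lemma box_bump_bounds: "0 \<le> box_bump a b r x" "box_bump a b r x \<le> 1"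
  unfolding box_bump_def
  by (auto intro!: prod_nonneg prod_le_1 mult_le_one mult_nonneg_nonneg simp: flat_1_bounds)

lemma box_bump_eq_0:
  assumes "r > 0" "x \<notin> box a b"
  shows "box_bump a b r x = 0"
proof -
  obtain i where "\<not> (a $ i < x $ i \<and> x $ i < b $ i)"
    using assms(2) by (auto simp: mem_box_cart)
  then have "flat 1 (r * (x $ i - a $ i)) * flat 1 (r * (b $ i - x $ i)) = 0"
    using assms(1) by (auto simp: flat_def zero_less_mult_iff)
  then show ?thesis
    unfolding box_bump_def by (intro prod_zero) auto
qed

lemma smooth_box_bump: "smooth (box_bump a b r)"
proof -
  have "C_diff k (\<lambda>x. \<Prod>i\<in>UNIV. flat 1 (r * x $ i + - (r * a $ i)) * flat 1 (- r * x $ i + r * b $ i))" for k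
    by (intro C_diff_prod C_diff_mult C_diff_flat_affine)
  then show ?thesis
    unfolding smooth_def box_bump_def by (simp add: algebra_simps)
qed

lemma continuous_on_box_bump: "continuous_on UNIV (box_bump a b r)"
  using smooth_box_bump C_diff_imp_continuous_on unfolding smooth_def by blast

lemma box_bump_in_test_functions:
  assumes "r > 0" "cbox a b \<subseteq> \<Omega>"
  shows "box_bump a b r \<in> test_functions \<Omega>"
proof -
  have "{x. box_bump a b r x \<noteq> 0} \<subseteq> cbox a b"
    using box_bump_eq_0[OF assms(1)] box_subset_cbox by blast
  then have "closure {x. box_bump a b r x \<noteq> 0} \<subseteq> cbox a b"
    by (rule closure_minimal) (rule closed_cbox)
  moreover from this have "compact (closure {x. box_bump a b r x \<noteq> 0})"
    by (meson bounded_cbox bounded_subset closed_closure compact_eq_bounded_closed)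
  ultimately show ?thesis
    using assms(2) smooth_box_bump by (auto simp: test_functions_def)
qed

text \<open>Inside the open box all factors tend to 1; elsewhere, faces included, the bump is
  identically 0. The parameter \<open>Suc n\<close> keeps the scaling positive.\<close>

lemma box_bump_tendsto_indicator:
  "(\<lambda>n. box_bump a b (real (Suc n)) x) \<longlonglongrightarrow> indicator (box a b) x"
proof (cases "x \<in> box a b")
  case True
  have lim: "(\<lambda>n. flat 1 (real (Suc n) * t)) \<longlonglongrightarrow> 1" if "t > 0" for t
  proof -
    have "(\<lambda>n. exp (- (inverse t * inverse (real (Suc n))))) \<longlonglongrightarrow> exp (- (inverse t * 0))"
      by (intro tendsto_intros LIMSEQ_inverse_real_of_nat)
    then show ?thesis
      using that by (simp add: flat_def field_simps zero_less_mult_iff del: of_nat_Suc)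
  qed
  have "(\<lambda>n. box_bump a b (real (Suc n)) x) \<longlonglongrightarrow> (\<Prod>i\<in>(UNIV::'a set). 1 * 1)"
    unfolding box_bump_def using True
    by (intro tendsto_prod tendsto_mult lim) (auto simp: mem_box_cart)
  then show ?thesis using True by simp
next
  case False
  then show ?thesis using box_bump_eq_0[of _ x a b] by (simp del: of_nat_Suc)
qed


section \<open>The fundamental lemma of the calculus of variations\<close>

text \<open>Open boxes form an intersection-stable generator of the Borel sets, so a Dynkin argument
  makes the integral of \<open>f\<close> vanish over every Borel set, and completion extends this to
  Lebesgue sets. Hence \<open>f\<close> and 0 agree as densities.\<close>

lemma AE_eq_0_if_box_integrals_eq_0:
  fixes f :: "'a::euclidean_space \<Rightarrow> real"
  assumes f: "integrable lebesgue f"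
    and box: "\<And>a b. (LINT x:box a b|lebesgue. f x) = 0"
  shows "AE x in lebesgue. f x = 0"
proof (rule density_unique_real[OF f, of "\<lambda>_. 0"])
  \<comment> \<open>The complement case of the induction needs the integral over the whole space,
    obtained by exhausting it with growing boxes.\<close>
  have total: "(LINT x|lebesgue. f x) = 0"
  proof (rule LIMSEQ_unique)
    let ?B = "\<lambda>n::nat. box (- (real n *\<^sub>R One)) (real n *\<^sub>R One) :: 'a set"
    show "(\<lambda>n. LINT x:?B n|lebesgue. f x) \<longlonglongrightarrow> (LINT x|lebesgue. f x)"
      unfolding set_lebesgue_integral_def
    proof (rule integral_dominated_convergence[where w="\<lambda>x. norm (f x)"])
      show "AE x in lebesgue. (\<lambda>n. indicator (?B n) x *\<^sub>R f x) \<longlonglongrightarrow> f x"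
      proof (rule AE_I2)
        fix x :: 'a
        obtain N where N: "x \<in> ?B N"
          using UN_box_eq_UNIV by blast
        have "x \<in> ?B n" if "n \<ge> N" for n
          using N that by (fastforce simp: mem_box)
        then have "eventually (\<lambda>n. indicator (?B n) x *\<^sub>R f x = f x) sequentially"
          by (auto simp: eventually_sequentially intro!: exI[of _ N])
        then show "(\<lambda>n. indicator (?B n) x *\<^sub>R f x) \<longlonglongrightarrow> f x"
          by (rule tendsto_eventually)
      qed
      show "(\<lambda>x. indicator (?B n) x *\<^sub>R f x) \<in> borel_measurable lebesgue" for n
        using f by (intro borel_measurable_scaleR borel_measurable_indicator) auto
    qed (use f in \<open>auto split: split_indicator\<close>)
    show "(\<lambda>n. LINT x:?B n|lebesgue. f x) \<longlonglongrightarrow> 0"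
      by (simp add: box)
  qed
  have borel: "(LINT x:A|lebesgue. f x) = 0" if "A \<in> sets (borel :: 'a measure)" for A
  proof -
    let ?G = "range (\<lambda>(a, b). box a b :: 'a set)"
    have sets: "sigma_sets UNIV ?G = sets borel"
      by (simp add: borel_eq_box)
    have int: "set_integrable lebesgue A f" if "A \<in> sets borel" for A
      unfolding set_integrable_def using f that
      by (intro integrable_mult_indicator) auto
    have "Int_stable ?G"
      by (auto simp: Int_stable_def box_Int_box)
    moreover have "?G \<subseteq> Pow UNIV"
      by simp
    moreover have "A \<in> sigma_sets UNIV ?G"
      using that by (simp add: sets)
    ultimately show ?thesis
    proof (induction rule: sigma_sets_induct_disjoint)
      case (compl A)
      then have "A \<in> sets borel" by (simp add: sets)
      then have "(LINT x:UNIV|lebesgue. f x) = (LINT x:A|lebesgue. f x) + (LINT x:UNIV - A|lebesgue. f x)"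
        using set_integral_Un[of A "UNIV - A" lebesgue f] int by simp
      then show ?case
        using compl.IH total by (simp add: set_lebesgue_integral_def)
    next
      case (union A)
      then have "(LINT x:(\<Union>i. A i)|lebesgue. f x) = (\<Sum>i. LINT x:A i|lebesgue. f x)"
        by (intro lebesgue_integral_countable_add int)
           (auto simp: sets disjoint_family_on_def range_subsetD)
      then show ?case
        using union.IH by simp
    qed (use box in \<open>auto simp: set_lebesgue_integral_def\<close>)
  qed
  show "integrable lebesgue (\<lambda>_::'a. 0::real)"
    by simp
  fix A :: "'a set"
  assume A: "A \<in> sets lebesgue"
  \<comment> \<open>\<open>lebesgue\<close> completes \<open>lborel\<close>: the main part of
    \<open>A\<close> is a Borel set that differs from \<open>A\<close> by a null set.\<close>
  then have main: "main_part lborel A \<in> sets lborel"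
    by (rule main_part_sets)
  have "AE x in lebesgue. x \<in> main_part lborel A \<longleftrightarrow> x \<in> A"
    using AE_completion[OF AE_in_main_part[OF A]] .
  then have "AE x in lebesgue. indicator A x *\<^sub>R f x = indicator (main_part lborel A) x *\<^sub>R f x"
    by eventually_elim (simp split: split_indicator)
  then have "(LINT x:A|lebesgue. f x) = (LINT x:main_part lborel A|lebesgue. f x)"
    unfolding set_lebesgue_integral_def using A main f
    by (intro integral_cong_AE borel_measurable_scaleR borel_measurable_indicator) auto
  then show "(LINT x:A|lebesgue. f x) = (LINT x:A|lebesgue. 0)"
    using main borel by (simp add: set_lebesgue_integral_def)
qed

text \<open>On \<open>K\<close> the continuous factor is bounded and \<open>f\<close> is integrable;
  off \<open>K\<close> the product vanishes.\<close>

lemma integrable_mult_compact_support: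
  fixes f \<psi> :: "real^'d \<Rightarrow> real"
  assumes f: "locally_integrable \<Omega> f" and "open \<Omega>"
    and K: "compact K" "K \<subseteq> \<Omega>"
    and \<psi>: "continuous_on UNIV \<psi>" "\<And>x. x \<notin> K \<Longrightarrow> \<psi> x = 0"
  shows "integrable (lebesgue_on \<Omega>) (\<lambda>x. f x * \<psi> x)"
proof -
  have "bounded (\<psi> ` K)"
    using K \<psi> by (intro compact_imp_bounded compact_continuous_image) (auto intro: continuous_on_subset)
  then obtain B where B: "\<And>x. x \<in> K \<Longrightarrow> norm (\<psi> x) \<le> B"
    by (auto simp: bounded_iff)
  have fK: "integrable lebesgue (\<lambda>x. indicator K x *\<^sub>R f x)"
    using f K by (auto simp: locally_integrable_def set_integrable_def)
  have [measurable]: "\<psi> \<in> borel_measurable lebesgue"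
    using \<psi>(1) by (simp add: borel_measurable_continuous_onI measurable_completion)
  have "integrable lebesgue (\<lambda>x. (indicator K x *\<^sub>R f x) * \<psi> x)"
  proof (rule Bochner_Integration.integrable_bound)
    show "integrable lebesgue (\<lambda>x. B * norm (indicator K x *\<^sub>R f x))"
      using fK by (intro integrable_mult_right integrable_norm)
    show "(\<lambda>x. (indicator K x *\<^sub>R f x) * \<psi> x) \<in> borel_measurable lebesgue"
      using fK by (intro borel_measurable_times) auto
    show "AE x in lebesgue. norm ((indicator K x *\<^sub>R f x) * \<psi> x) \<le> norm (B * norm (indicator K x *\<^sub>R f x))"
    proof (rule AE_I2)
      fix x
      \<comment> \<open>If \<open>K\<close> is empty, the bound \<open>B\<close> may be negative,
        hence the absolute value.\<close>
      have "x \<in> K \<Longrightarrow> norm (\<psi> x) \<le> \<bar>B\<bar>"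
        using B[of x] by linarith
      then show "norm ((indicator K x *\<^sub>R f x) * \<psi> x) \<le> norm (B * norm (indicator K x *\<^sub>R f x))"
        by (auto simp: abs_mult mult.commute intro: mult_right_mono split: split_indicator)
    qed
  qed
  also have "(\<lambda>x. (indicator K x *\<^sub>R f x) * \<psi> x) = (\<lambda>x. indicator \<Omega> x *\<^sub>R (f x * \<psi> x))"
    using K \<psi>(2) by (auto simp: fun_eq_iff split: split_indicator)
  finally show ?thesis
    using \<open>open \<Omega>\<close> by (simp add: integrable_restrict_space)
qed

text \<open>An open set is a countable union of closed boxes, and countably many exceptional null
  sets may be united. This localises a claim to compact pieces, where local integrability is
  usable.\<close>

lemma AE_lebesgue_on_open_if_cboxes:
  fixes \<Omega> :: "'a::euclidean_space set"
  assumes "open \<Omega>"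
    and cbox: "\<And>a b. cbox a b \<subseteq> \<Omega> \<Longrightarrow> AE x in lebesgue. x \<in> cbox a b \<longrightarrow> P x"
  shows "AE x in lebesgue_on \<Omega>. P x"
proof -
  obtain D where D: "countable D" "\<And>X. X \<in> D \<Longrightarrow> X \<subseteq> \<Omega> \<and> (\<exists>a b. X = cbox a b)" "\<Union>D = \<Omega>"
    using open_countable_Union_open_cbox[OF \<open>open \<Omega>\<close>] by (metis PowD subsetD)
  have "AE x in lebesgue. \<forall>X\<in>D. x \<in> X \<longrightarrow> P x"
    using D(1,2) cbox by (intro AE_ball_countable[THEN iffD2]) blast+
  then have "AE x in lebesgue. x \<in> \<Omega> \<longrightarrow> P x"
    by eventually_elim (use D(3) in blast)
  then show ?thesis
    using \<open>open \<Omega>\<close> by (simp add: AE_restrict_space_iff)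
qed

text \<open>Testing with bumps that converge to the indicator of a box shows that \<open>f\<close>
  has integral 0 over every box whose closed box lies in \<Omega>. On each such box the cut-off of
  \<open>f\<close> is globally integrable and therefore vanishes almost everywhere.\<close>

lemma fundamental_lemma_calculus_of_variations:
  fixes f :: "real^'d \<Rightarrow> real"
  assumes f: "locally_integrable \<Omega> f" and "open \<Omega>"
    and zero: "\<And>\<phi>. \<phi> \<in> test_functions \<Omega> \<Longrightarrow> (LINT x|lebesgue_on \<Omega>. f x * \<phi> x) = 0"
  shows "AE x in lebesgue_on \<Omega>. f x = 0"
proof (rule AE_lebesgue_on_open_if_cboxes[OF \<open>open \<Omega>\<close>])
  have box: "(LINT x:box a b|lebesgue. f x) = 0" if ab: "cbox a b \<subseteq> \<Omega>" for a b
  proof (rule LIMSEQ_unique)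
    let ?\<phi> = "\<lambda>n. box_bump a b (real (Suc n))"
    have int: "integrable lebesgue (\<lambda>x. indicator (cbox a b) x *\<^sub>R f x)"
      using f ab by (auto simp: locally_integrable_def set_integrable_def)
    \<comment> \<open>The bump vanishes off the closed box, so \<open>f\<close> can be replaced by
      its cut-off, which is integrable on the whole space and serves as dominating function.\<close>
    have eq: "indicator \<Omega> x *\<^sub>R (f x * ?\<phi> n x) = (indicator (cbox a b) x *\<^sub>R f x) * ?\<phi> n x" for n x
    proof (cases "x \<in> cbox a b")
      case False
      then have "?\<phi> n x = 0"
        using box_subset_cbox by (intro box_bump_eq_0) auto
      then show ?thesis by simp
    qed (use ab in auto)
    have "(\<lambda>n. LINT x|lebesgue. (indicator (cbox a b) x *\<^sub>R f x) * ?\<phi> n x)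
        \<longlonglongrightarrow> (LINT x|lebesgue. indicator (box a b) x *\<^sub>R f x)"
    proof (rule integral_dominated_convergence[where w="\<lambda>x. norm (indicator (cbox a b) x *\<^sub>R f x)"])
      have meas: "?\<phi> n \<in> borel_measurable lebesgue" for n
        by (intro measurable_completion) (simp add: borel_measurable_continuous_onI continuous_on_box_bump)
      then show "(\<lambda>x. (indicator (cbox a b) x *\<^sub>R f x) * ?\<phi> n x) \<in> borel_measurable lebesgue" for n
        using int by (intro borel_measurable_times) auto
      \<comment> \<open>\<open>f\<close> is not assumed measurable outside \<Omega>; measurability
        is inherited from the integrable cut-off.\<close>
      have "indicator (box a b) x *\<^sub>R (indicator (cbox a b) x *\<^sub>R f x) = indicator (box a b) x *\<^sub>R f x" for x
        using box_subset_cbox[of a b] by (auto split: split_indicator)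
      moreover have "(\<lambda>x. indicator (box a b) x *\<^sub>R (indicator (cbox a b) x *\<^sub>R f x)) \<in> borel_measurable lebesgue"
        by (intro borel_measurable_scaleR[OF borel_measurable_indicator borel_measurable_integrable[OF int]]) simp
      ultimately show "(\<lambda>x. indicator (box a b) x *\<^sub>R f x) \<in> borel_measurable lebesgue"
        by (simp only:)
      show "integrable lebesgue (\<lambda>x. norm (indicator (cbox a b) x *\<^sub>R f x))"
        using int by (rule integrable_norm)
      show "AE x in lebesgue. (\<lambda>n. (indicator (cbox a b) x *\<^sub>R f x) * ?\<phi> n x)
          \<longlonglongrightarrow> indicator (box a b) x *\<^sub>R f x"
      proof (rule AE_I2)
        fix x
        have "(\<lambda>n. (indicator (cbox a b) x *\<^sub>R f x) * ?\<phi> n x)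
            \<longlonglongrightarrow> (indicator (cbox a b) x *\<^sub>R f x) * indicator (box a b) x"
          by (intro tendsto_intros box_bump_tendsto_indicator)
        also have "(indicator (cbox a b) x *\<^sub>R f x) * indicator (box a b) x = indicator (box a b) x *\<^sub>R f x"
          using box_subset_cbox[of a b] by (auto split: split_indicator)
        finally show "(\<lambda>n. (indicator (cbox a b) x *\<^sub>R f x) * ?\<phi> n x)
            \<longlonglongrightarrow> indicator (box a b) x *\<^sub>R f x" .
      qed
      show "AE x in lebesgue. norm ((indicator (cbox a b) x *\<^sub>R f x) * ?\<phi> n x)
          \<le> norm (indicator (cbox a b) x *\<^sub>R f x)" for n
        by (auto simp: abs_mult box_bump_bounds intro!: mult_left_le split: split_indicator)
    qed
    moreover have "(LINT x|lebesgue. (indicator (cbox a b) x *\<^sub>R f x) * ?\<phi> n x) = 0" for n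
      using zero[OF box_bump_in_test_functions[OF _ ab, of "real (Suc n)"]] \<open>open \<Omega>\<close>
      by (subst eq[symmetric]) (simp add: integral_restrict_space)
    ultimately show "(\<lambda>n. 0) \<longlonglongrightarrow> (LINT x:box a b|lebesgue. f x)"
      by (simp add: set_lebesgue_integral_def)
  qed simp
  fix p q :: "real^'d"
  assume pq: "cbox p q \<subseteq> \<Omega>"
  have int: "integrable lebesgue (\<lambda>x. indicator (box p q) x *\<^sub>R f x)"
    using f pq set_integrable_subset[of lebesgue "cbox p q" f "box p q"] box_subset_cbox[of p q]
    by (auto simp: locally_integrable_def set_integrable_def)
  have "AE x in lebesgue. indicator (box p q) x *\<^sub>R f x = 0"
  proof (rule AE_eq_0_if_box_integrals_eq_0[OF int])
    fix a b :: "real^'d"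
    obtain c d where cd: "box a b \<inter> box p q = box c d"
      by (simp add: box_Int_box)
    have "box c d \<subseteq> cbox p q"
      using cd box_subset_cbox[of p q] by blast
    then have "closure (box c d) \<subseteq> cbox p q"
      by (rule closure_minimal) (rule closed_cbox)
    \<comment> \<open>An empty \<open>box c d\<close> is kept apart: it says nothing about the
      position of \<open>cbox c d\<close>, but its integral is trivially 0.\<close>
    then have "cbox c d \<subseteq> cbox p q \<or> box c d = {}"
      using closure_box[of c d] by blast
    then have "(LINT x:box c d|lebesgue. f x) = 0"
      using box[of c d] pq by (auto simp: set_lebesgue_integral_def)
    then show "(LINT x:box a b|lebesgue. indicator (box p q) x *\<^sub>R f x) = 0"
      by (simp add: set_lebesgue_integral_def cd[symmetric] indicator_inter_arith mult.assoc)
  qed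
  \<comment> \<open>The open and the closed box differ only by the faces, a null set.\<close>
  moreover have "AE x in lebesgue. x \<notin> cbox p q - box p q"
    by (rule AE_not_in[OF negligible_frontier_interval[unfolded negligible_iff_null_sets]])
  ultimately show "AE x in lebesgue. x \<in> cbox p q \<longrightarrow> f x = 0"
    by eventually_elim (auto simp: indicator_def split: if_splits)
qed


section \<open>Weak gradients\<close>

lemma locally_integrable_bounded_linear:
  assumes "locally_integrable \<Omega> f" "bounded_linear h"
  shows "locally_integrable \<Omega> (\<lambda>x. h (f x))"
  using assms absolutely_integrable_linear[OF _ assms(2)]
  by (auto simp: locally_integrable_def o_def)

lemma locally_integrable_add_scaleR:
  assumes "locally_integrable \<Omega> f" "locally_integrable \<Omega> g"
  shows "locally_integrable \<Omega> (\<lambda>x. f x + c *\<^sub>R g x)"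
  using assms by (auto simp: locally_integrable_def intro!: set_integral_add)

lemma locally_integrable_diff:
  assumes "locally_integrable \<Omega> f" "locally_integrable \<Omega> g"
  shows "locally_integrable \<Omega> (\<lambda>x. f x - g x)"
  using assms by (auto simp: locally_integrable_def intro!: set_integral_diff)

lemma partial_deriv_eq_0_outside_support:
  assumes "x \<notin> closure {y. \<phi> y \<noteq> 0}"
  shows "partial_deriv j \<phi> x = 0"
proof -
  have "((\<lambda>_. 0) has_derivative (\<lambda>_. 0)) (at x)"
    by simp
  then have "(\<phi> has_derivative (\<lambda>_. 0)) (at x)"
    by (rule has_derivative_transform_within_open[where s="- closure {y. \<phi> y \<noteq> 0}"])
       (use assms closure_subset[of "{y. \<phi> y \<noteq> 0}"] in auto)
  then show ?thesis
    by (rule partial_deriv_eq)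
qed

text \<open>A test function and its partial derivatives vanish off one compact set inside \<Omega>.
  Integrability is what permits splitting the integrals that define a weak gradient.\<close>

lemma
  assumes f: "locally_integrable \<Omega> f" and "open \<Omega>" and \<phi>: "\<phi> \<in> test_functions \<Omega>"
  shows integrable_mult_test_function: "integrable (lebesgue_on \<Omega>) (\<lambda>x. f x * \<phi> x)"
    and integrable_mult_partial_deriv_test_function:
      "integrable (lebesgue_on \<Omega>) (\<lambda>x. f x * partial_deriv j \<phi> x)"
proof -
  let ?K = "closure {x. \<phi> x \<noteq> 0}"
  have K: "compact ?K" "?K \<subseteq> \<Omega>" and C: "C_diff k \<phi>" for k
    using \<phi> by (auto simp: test_functions_def smooth_def)
  have zero: "x \<notin> ?K \<Longrightarrow> \<phi> x = 0" for x
    using closure_subset[of "{x. \<phi> x \<noteq> 0}"] by blast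
  show "integrable (lebesgue_on \<Omega>) (\<lambda>x. f x * \<phi> x)"
    by (rule integrable_mult_compact_support[OF f \<open>open \<Omega>\<close> K C_diff_imp_continuous_on[OF C] zero])
  have "C_diff 0 (partial_deriv j \<phi>)"
    using C[of "Suc 0"] by simp
  then show "integrable (lebesgue_on \<Omega>) (\<lambda>x. f x * partial_deriv j \<phi> x)"
    by (intro integrable_mult_compact_support[OF f \<open>open \<Omega>\<close> K] partial_deriv_eq_0_outside_support)
       simp_all
qed

lemma
  assumes "has_weak_gradient \<Omega> u G"
  shows has_weak_gradient_locally_integrable_component: "locally_integrable \<Omega> (\<lambda>x. u x $ i)"
    and has_weak_gradient_locally_integrable_entry: "locally_integrable \<Omega> (\<lambda>x. G x $ i $ j)"
proof -
  have u: "locally_integrable \<Omega> u" and G: "locally_integrable \<Omega> G"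
    using assms by (simp_all add: has_weak_gradient_def)
  show "locally_integrable \<Omega> (\<lambda>x. u x $ i)"
    by (rule locally_integrable_bounded_linear[OF u bounded_linear_vec_nth])
  have "locally_integrable \<Omega> (\<lambda>x. G x $ i)"
    by (rule locally_integrable_bounded_linear[OF G bounded_linear_vec_nth])
  then show "locally_integrable \<Omega> (\<lambda>x. G x $ i $ j)"
    by (rule locally_integrable_bounded_linear[OF _ bounded_linear_vec_nth])
qed

text \<open>Both candidates have the same integrals against every test function, so the fundamental
  lemma applies to each entry of their difference; there are finitely many entries.\<close>

lemma has_weak_gradient_unique:
  assumes "open \<Omega>" and G: "has_weak_gradient \<Omega> u G" and H: "has_weak_gradient \<Omega> u H"
  shows "AE x in lebesgue_on \<Omega>. G x = H x"
proof -
  have "AE x in lebesgue_on \<Omega>. G x $ i $ j - H x $ i $ j = 0" for i j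
  proof (rule fundamental_lemma_calculus_of_variations[OF _ \<open>open \<Omega>\<close>])
    note loc = has_weak_gradient_locally_integrable_entry[OF G, of i j]
      has_weak_gradient_locally_integrable_entry[OF H, of i j]
    show "locally_integrable \<Omega> (\<lambda>x. G x $ i $ j - H x $ i $ j)"
      by (intro locally_integrable_diff loc)
    fix \<phi> assume \<phi>: "\<phi> \<in> test_functions \<Omega>"
    have "- (LINT x|lebesgue_on \<Omega>. G x $ i $ j * \<phi> x) = (LINT x|lebesgue_on \<Omega>. u x $ i * partial_deriv j \<phi> x)"
      and "- (LINT x|lebesgue_on \<Omega>. H x $ i $ j * \<phi> x) = (LINT x|lebesgue_on \<Omega>. u x $ i * partial_deriv j \<phi> x)"
      using G H \<phi> unfolding has_weak_gradient_def by simp_all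
    then have "(LINT x|lebesgue_on \<Omega>. G x $ i $ j * \<phi> x) = (LINT x|lebesgue_on \<Omega>. H x $ i $ j * \<phi> x)"
      by linarith
    then show "(LINT x|lebesgue_on \<Omega>. (G x $ i $ j - H x $ i $ j) * \<phi> x) = 0"
      using integrable_mult_test_function[OF loc(1) \<open>open \<Omega>\<close> \<phi>]
        integrable_mult_test_function[OF loc(2) \<open>open \<Omega>\<close> \<phi>]
      by (simp add: left_diff_distrib)
  qed
  then have "AE x in lebesgue_on \<Omega>. \<forall>i j. G x $ i $ j - H x $ i $ j = 0"
    by (simp add: AE_all_countable)
  then show ?thesis
    by eventually_elim (simp add: vec_eq_iff)
qed

text \<open>The defining identity is linear in the pair of function and gradient. Sum and multiple
  are combined because the scheme forms exactly such expressions
  \<open>u x + c *\<^sub>R v x\<close>.\<close>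

lemma has_weak_gradient_add_scaleR:
  assumes "open \<Omega>" and G: "has_weak_gradient \<Omega> u G" and H: "has_weak_gradient \<Omega> v H"
  shows "has_weak_gradient \<Omega> (\<lambda>x. u x + c *\<^sub>R v x) (\<lambda>x. G x + c *\<^sub>R H x)"
  unfolding has_weak_gradient_def
proof (intro conjI ballI allI)
  show "locally_integrable \<Omega> (\<lambda>x. u x + c *\<^sub>R v x)" "locally_integrable \<Omega> (\<lambda>x. G x + c *\<^sub>R H x)"
    using G H by (auto simp: has_weak_gradient_def intro: locally_integrable_add_scaleR)
  fix \<phi> i j assume \<phi>: "\<phi> \<in> test_functions \<Omega>"
  note int = integrable_mult_test_function[OF _ \<open>open \<Omega>\<close> \<phi>]
    integrable_mult_partial_deriv_test_function[OF _ \<open>open \<Omega>\<close> \<phi>]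
  have "(LINT x|lebesgue_on \<Omega>. (u x + c *\<^sub>R v x) $ i * partial_deriv j \<phi> x)
      = (LINT x|lebesgue_on \<Omega>. u x $ i * partial_deriv j \<phi> x + c * (v x $ i * partial_deriv j \<phi> x))"
    by (simp add: algebra_simps)
  also have "\<dots> = (LINT x|lebesgue_on \<Omega>. u x $ i * partial_deriv j \<phi> x)
      + c * (LINT x|lebesgue_on \<Omega>. v x $ i * partial_deriv j \<phi> x)"
    by (simp add: int has_weak_gradient_locally_integrable_component[OF G]
        has_weak_gradient_locally_integrable_component[OF H])
  also have "\<dots> = - ((LINT x|lebesgue_on \<Omega>. G x $ i $ j * \<phi> x) + c * (LINT x|lebesgue_on \<Omega>. H x $ i $ j * \<phi> x))"
    using G H \<phi> by (simp add: has_weak_gradient_def)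
  also have "\<dots> = - (LINT x|lebesgue_on \<Omega>. G x $ i $ j * \<phi> x + c * (H x $ i $ j * \<phi> x))"
    by (simp add: int has_weak_gradient_locally_integrable_entry[OF G]
        has_weak_gradient_locally_integrable_entry[OF H])
  also have "\<dots> = - (LINT x|lebesgue_on \<Omega>. (G x + c *\<^sub>R H x) $ i $ j * \<phi> x)"
    by (simp add: algebra_simps)
  finally show "(LINT x|lebesgue_on \<Omega>. (u x + c *\<^sub>R v x) $ i * partial_deriv j \<phi> x)
      = - (LINT x|lebesgue_on \<Omega>. (G x + c *\<^sub>R H x) $ i $ j * \<phi> x)" .
qed


section \<open>The spaces \<open>L2\<close> and \<open>H1\<close>\<close>

lemma L2_integrable_inner:
  assumes "f \<in> L2 M" "g \<in> L2 M"
  shows "integrable M (\<lambda>x. f x \<bullet> g x)"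
proof (rule Bochner_Integration.integrable_bound)
  show "integrable M (\<lambda>x. (norm (f x))\<^sup>2 + (norm (g x))\<^sup>2)"
    using assms by (auto simp: L2_def)
  show "(\<lambda>x. f x \<bullet> g x) \<in> borel_measurable M"
    using assms by (auto simp: L2_def)
  have "\<bar>y \<bullet> z\<bar> \<le> (norm y)\<^sup>2 + (norm z)\<^sup>2" for y z :: 'b
    using Cauchy_Schwarz_ineq2[of y z] sum_squares_bound[of "norm y" "norm z"]
      mult_nonneg_nonneg[of "norm y" "norm z"]
    by simp
  then show "AE x in M. norm (f x \<bullet> g x) \<le> norm ((norm (f x))\<^sup>2 + (norm (g x))\<^sup>2)"
    by simp
qed

lemma L2_add_scaleR:
  assumes f: "f \<in> L2 M" and g: "g \<in> L2 M"
  shows "(\<lambda>x. f x + c *\<^sub>R g x) \<in> L2 M"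
proof -
  have "(norm (f x + c *\<^sub>R g x))\<^sup>2 = f x \<bullet> f x + 2 * c * (f x \<bullet> g x) + c\<^sup>2 * (g x \<bullet> g x)" for x
    by (simp add: power2_norm_eq_inner inner_add_left inner_add_right inner_commute)
       (simp add: power2_eq_square)
  then show ?thesis
    using assms L2_integrable_inner[OF f f] L2_integrable_inner[OF f g] L2_integrable_inner[OF g g]
    by (auto simp: L2_def)
qed

text \<open>Completeness of Lebesgue measure, applied to the extensions by zero outside
  \<open>S\<close>.\<close>

lemma borel_measurable_lebesgue_on_AE:
  fixes f g :: "'a::euclidean_space \<Rightarrow> 'b::euclidean_space"
  assumes "S \<in> sets lebesgue" "f \<in> borel_measurable (lebesgue_on S)" "AE x in lebesgue_on S. f x = g x"
  shows "g \<in> borel_measurable (lebesgue_on S)"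
proof -
  have "AE x in lebesgue. indicator S x *\<^sub>R f x = indicator S x *\<^sub>R g x"
    using assms by (auto simp: AE_restrict_space_iff split: split_indicator elim: eventually_mono)
  then show ?thesis
    using assms borel_measurable_AE[of "\<lambda>x. indicator S x *\<^sub>R f x" "\<lambda>x. indicator S x *\<^sub>R g x"]
    by (simp add: borel_measurable_restrict_space_iff)
qed

lemma L2_AE_cong:
  fixes f g :: "'a::euclidean_space \<Rightarrow> 'b::euclidean_space"
  assumes S: "S \<in> sets lebesgue" and f: "f \<in> L2 (lebesgue_on S)"
    and ae: "AE x in lebesgue_on S. f x = g x"
  shows "g \<in> L2 (lebesgue_on S)"
proof -
  have g: "g \<in> borel_measurable (lebesgue_on S)"
    using borel_measurable_lebesgue_on_AE[OF S _ ae] f by (simp add: L2_def)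
  have "integrable (lebesgue_on S) (\<lambda>x. (norm (g x))\<^sup>2)"
    using f g ae by (subst integrable_cong_AE[where g="\<lambda>x. (norm (f x))\<^sup>2"]) (auto simp: L2_def)
  with g show ?thesis by (simp add: L2_def)
qed

text \<open>The choice behind \<open>weak_grad\<close> need not return the square-integrable witness
  from \<open>H1\<close>, but uniqueness makes the two equal almost everywhere, and
  \<open>L2\<close> respects such changes.\<close>

lemma
  assumes "open \<Omega>" "u \<in> H1 \<Omega>"
  shows H1_has_weak_gradient_weak_grad: "has_weak_gradient \<Omega> u (weak_grad \<Omega> u)"
    and H1_weak_grad_L2: "weak_grad \<Omega> u \<in> L2 (lebesgue_on \<Omega>)"
proof -
  obtain G where G: "G \<in> L2 (lebesgue_on \<Omega>)" "has_weak_gradient \<Omega> u G"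
    using assms(2) by (auto simp: H1_def)
  then show grad: "has_weak_gradient \<Omega> u (weak_grad \<Omega> u)"
    unfolding weak_grad_def by (metis someI)
  show "weak_grad \<Omega> u \<in> L2 (lebesgue_on \<Omega>)"
    using L2_AE_cong[OF _ G(1) has_weak_gradient_unique[OF assms(1) G(2) grad]] assms(1) by simp
qed

lemma H1_add_scaleR:
  assumes "open \<Omega>" "u \<in> H1 \<Omega>" "v \<in> H1 \<Omega>"
  shows "(\<lambda>x. u x + c *\<^sub>R v x) \<in> H1 \<Omega>"
proof -
  obtain G H where "G \<in> L2 (lebesgue_on \<Omega>)" "has_weak_gradient \<Omega> u G"
    and "H \<in> L2 (lebesgue_on \<Omega>)" "has_weak_gradient \<Omega> v H"
    using assms by (auto simp: H1_def)
  then have "has_weak_gradient \<Omega> (\<lambda>x. u x + c *\<^sub>R v x) (\<lambda>x. G x + c *\<^sub>R H x)"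
    and "(\<lambda>x. G x + c *\<^sub>R H x) \<in> L2 (lebesgue_on \<Omega>)"
    using assms(1) by (simp_all add: has_weak_gradient_add_scaleR L2_add_scaleR)
  then show ?thesis
    using assms by (auto simp: H1_def intro: L2_add_scaleR)
qed

lemma weak_grad_add_scaleR:
  assumes "open \<Omega>" "u \<in> H1 \<Omega>" "v \<in> H1 \<Omega>"
  shows "AE x in lebesgue_on \<Omega>.
    weak_grad \<Omega> (\<lambda>x. u x + c *\<^sub>R v x) x = weak_grad \<Omega> u x + c *\<^sub>R weak_grad \<Omega> v x"
  using assms
  by (intro has_weak_gradient_unique[of \<Omega> "\<lambda>x. u x + c *\<^sub>R v x"] has_weak_gradient_add_scaleR
      H1_has_weak_gradient_weak_grad H1_add_scaleR)

section \<open>The gradient form as a symmetric bilinear form on \<open>H1\<close>\<close>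

lemma grad_ip_commute: "grad_ip \<Omega> u v = grad_ip \<Omega> v u"
  by (simp add: grad_ip_def L2_ip_def inner_commute)

lemma grad_ip_add_scaleR_left:
  assumes "open \<Omega>" "u \<in> H1 \<Omega>" "v \<in> H1 \<Omega>" "w \<in> H1 \<Omega>"
  shows "grad_ip \<Omega> (\<lambda>x. u x + c *\<^sub>R v x) w = grad_ip \<Omega> u w + c * grad_ip \<Omega> v w"
proof -
  note L2 = H1_weak_grad_L2[OF assms(1)]
  note int = L2_integrable_inner[OF L2[OF assms(2)] L2[OF assms(4)]]
    L2_integrable_inner[OF L2[OF assms(3)] L2[OF assms(4)]]
  have "grad_ip \<Omega> (\<lambda>x. u x + c *\<^sub>R v x) w = (LINT x|lebesgue_on \<Omega>.
      weak_grad \<Omega> u x \<bullet> weak_grad \<Omega> w x + c * (weak_grad \<Omega> v x \<bullet> weak_grad \<Omega> w x))"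
    unfolding grad_ip_def L2_ip_def
  proof (rule integral_cong_AE)
    show "AE x in lebesgue_on \<Omega>. weak_grad \<Omega> (\<lambda>x. u x + c *\<^sub>R v x) x \<bullet> weak_grad \<Omega> w x
        = weak_grad \<Omega> u x \<bullet> weak_grad \<Omega> w x + c * (weak_grad \<Omega> v x \<bullet> weak_grad \<Omega> w x)"
      using weak_grad_add_scaleR[OF assms(1-3), of c] by eventually_elim (simp add: inner_add_left)
    show "(\<lambda>x. weak_grad \<Omega> (\<lambda>x. u x + c *\<^sub>R v x) x \<bullet> weak_grad \<Omega> w x) \<in> borel_measurable (lebesgue_on \<Omega>)"
      by (intro borel_measurable_integrable L2_integrable_inner L2 H1_add_scaleR assms)
  qed (use int in auto)
  then show ?thesis
    using int by (simp add: grad_ip_def L2_ip_def)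
qed

lemma grad_ip_self_add_scaleR:
  assumes "open \<Omega>" "u \<in> H1 \<Omega>" "v \<in> H1 \<Omega>"
  shows "grad_ip \<Omega> (\<lambda>x. u x + c *\<^sub>R v x) (\<lambda>x. u x + c *\<^sub>R v x)
    = grad_ip \<Omega> u u + 2 * c * grad_ip \<Omega> u v + c\<^sup>2 * grad_ip \<Omega> v v"
proof -
  let ?w = "\<lambda>x. u x + c *\<^sub>R v x"
  have w: "?w \<in> H1 \<Omega>"
    using assms by (rule H1_add_scaleR)
  have "grad_ip \<Omega> ?w ?w = grad_ip \<Omega> ?w u + c * grad_ip \<Omega> ?w v"
    using grad_ip_add_scaleR_left[OF assms w] grad_ip_commute[of \<Omega> ?w] by simp
  then show ?thesis
    using grad_ip_add_scaleR_left[OF assms assms(2), of c] grad_ip_add_scaleR_left[OF assms assms(3), of c]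
      grad_ip_commute[of \<Omega> v u]
    by (simp add: power2_eq_square algebra_simps)
qed

lemma L2_ip_self_nonneg: "0 \<le> L2_ip M f f"
  unfolding L2_ip_def by (rule integral_nonneg_AE) simp

lemma L2_norm_power2: "(L2_norm M f)\<^sup>2 = L2_ip M f f"
  by (simp add: induced_norm_def L2_ip_self_nonneg)


section \<open>The energy identity\<close>

text \<open>The increment \<open>d\<close> satisfies the constraint imposed on test functions, so
  \<open>v = d\<close> is admissible. Multiplied by \<tau>, the tested equation cancels the mixed
  term in the expansion of the new energy; the quadratic terms leave the coefficient
  \<open>s * \<tau> - \<tau>\<^sup>2 / 2\<close>.\<close>

lemma constrained_step_energy:
  assumes "open \<Omega>" and u: "u \<in> H1 \<Omega>"
    and step: "constrained_step \<Omega> \<Gamma> star s w u d"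
    and nonneg: "0 \<le> star d d"
  shows "1 / 2 * grad_ip \<Omega> (\<lambda>x. u x + \<tau> *\<^sub>R d x) (\<lambda>x. u x + \<tau> *\<^sub>R d x)
      + \<tau> * (induced_norm star d)\<^sup>2 + (s * \<tau> - \<tau>\<^sup>2 / 2) * grad_ip \<Omega> d d
    = 1 / 2 * grad_ip \<Omega> u u"
proof -
  have d: "d \<in> H1 \<Omega>"
    using step by (simp add: constrained_step_def H1D_def)
  have "star d d + grad_ip \<Omega> (\<lambda>x. u x + s *\<^sub>R d x) d = 0"
    using step by (simp add: constrained_step_def)
  then have star: "star d d = - grad_ip \<Omega> u d - s * grad_ip \<Omega> d d"
    using grad_ip_add_scaleR_left[OF \<open>open \<Omega>\<close> u d d] by simp
  \<comment> \<open>Squaring the square root returns \<open>star d d\<close> because this value is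
    nonnegative.\<close>
  have "(induced_norm star d)\<^sup>2 = - grad_ip \<Omega> u d - s * grad_ip \<Omega> d d"
    using nonneg star by (simp add: induced_norm_def)
  then show ?thesis
    by (simp only: grad_ip_self_add_scaleR[OF \<open>open \<Omega>\<close> u d]) (simp add: algebra_simps)
qed

theorem proposition2p1:
  fixes \<Omega> \<Gamma>\<^sub>D :: "(real^'d) set"
    and u\<^sub>D :: "real^'d \<Rightarrow> real^'l"
    and star :: "(real^'d \<Rightarrow> real^'l) \<Rightarrow> (real^'d \<Rightarrow> real^'l) \<Rightarrow> real"
    and c \<theta> \<mu> \<tau> :: real
    and u :: "nat \<Rightarrow> real^'d \<Rightarrow> real^'l"
    and m :: nat
  assumes "bounded_lipschitz_domain \<Omega>"
    and "\<Gamma>\<^sub>D \<in> sets (surface_measure \<Omega>)" and "emeasure (surface_measure \<Omega>) \<Gamma>\<^sub>D > 0"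
    and "\<exists>w\<in>H1 \<Omega>. (AE x in lebesgue_on \<Omega>. norm (w x) = 1) \<and> has_trace_on \<Omega> \<Gamma>\<^sub>D w u\<^sub>D"
    and "star = L2_ip (lebesgue_on \<Omega>) \<or> star = grad_ip \<Omega>"
    and "c > 0"
    and "\<forall>v\<in>H1D \<Omega> \<Gamma>\<^sub>D. L2_norm (lebesgue_on \<Omega>) v \<le> sqrt c * induced_norm star v"
    and "0 < \<theta>" and "\<theta> \<le> 1" and "0 \<le> \<mu>" and "\<mu> \<le> 1" and "\<tau> > 0"
    and "theta_mu_sequence \<Omega> \<Gamma>\<^sub>D u\<^sub>D star \<theta> \<mu> \<tau> u"
    and "m \<ge> 2"
  shows "1 / 2 * (L2_norm (lebesgue_on \<Omega>) (weak_grad \<Omega> (u m)))\<^sup>2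
       + \<tau> * (\<Sum>n=1..m. (induced_norm star (diff_quot \<tau> u n))\<^sup>2)
       + \<tau>\<^sup>2 / 2 * (L2_norm (lebesgue_on \<Omega>) (weak_grad \<Omega> (diff_quot \<tau> u 1)))\<^sup>2
       + (\<theta> - 1 / 2) * \<tau>\<^sup>2 *
           (\<Sum>n=2..m. (L2_norm (lebesgue_on \<Omega>) (weak_grad \<Omega> (diff_quot \<tau> u n)))\<^sup>2)
       = 1 / 2 * (L2_norm (lebesgue_on \<Omega>) (weak_grad \<Omega> (u 0)))\<^sup>2"
proof -
  let ?d = "diff_quot \<tau> u"
  let ?E = "\<lambda>v. grad_ip \<Omega> v v"
  let ?S = "\<lambda>n. (induced_norm star (?d n))\<^sup>2"
  have "open \<Omega>"
    using assms(1) by (simp add: bounded_lipschitz_domain_def)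
  have grad: "(L2_norm (lebesgue_on \<Omega>) (weak_grad \<Omega> v))\<^sup>2 = ?E v" for v :: "real^'d \<Rightarrow> real^'l"
    by (simp add: L2_norm_power2 grad_ip_def)
  have nonneg: "0 \<le> star v v" for v
    using assms(5) by (auto simp: grad_ip_def L2_ip_self_nonneg)
  have update: "u (Suc n) = (\<lambda>x. u n x + \<tau> *\<^sub>R ?d (Suc n) x)" for n
    using \<open>\<tau> > 0\<close> by (simp add: diff_quot_def)
  \<comment> \<open>Shifted indices: \<open>n = 0\<close> is the implicit Euler step producing
    \<open>u 1\<close>. The constraint field stays existential, as it does not enter the energy
    balance.\<close>
  have step: "\<exists>w. constrained_step \<Omega> \<Gamma>\<^sub>D star (if n = 0 then \<tau> else \<theta> * \<tau>) w (u n) (?d (Suc n))" for n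
    using assms(13) unfolding theta_mu_sequence_def by (cases n) (auto dest!: spec[of _ "Suc n"])
  have H1: "u n \<in> H1 \<Omega>" for n
  proof (induction n)
    case 0
    then show ?case using assms(13) by (simp add: theta_mu_sequence_def)
  next
    case (Suc n)
    have "?d (Suc n) \<in> H1 \<Omega>"
      using step[of n] by (auto simp: constrained_step_def H1D_def)
    then show ?case
      unfolding update[of n] by (intro H1_add_scaleR \<open>open \<Omega>\<close> Suc)
  qed
  \<comment> \<open>The coefficient of the last term is \<open>\<tau>\<^sup>2 / 2\<close> for
    \<open>n = 0\<close> and \<open>(\<theta> - 1 / 2) * \<tau>\<^sup>2\<close> afterwards.\<close>
  have energy: "1 / 2 * ?E (u (Suc n)) + \<tau> * ?S (Suc n)
      + ((if n = 0 then \<tau> else \<theta> * \<tau>) * \<tau> - \<tau>\<^sup>2 / 2) * ?E (?d (Suc n)) = 1 / 2 * ?E (u n)" for n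
  proof -
    obtain w where "constrained_step \<Omega> \<Gamma>\<^sub>D star (if n = 0 then \<tau> else \<theta> * \<tau>) w (u n) (?d (Suc n))"
      using step[of n] by blast
    from constrained_step_energy[where \<tau>=\<tau>, OF \<open>open \<Omega>\<close> H1 this nonneg] show ?thesis
      by (simp only: update[of n])
  qed
  have "1 / 2 * ?E (u m) + \<tau> * (\<Sum>n=1..m. ?S n) + \<tau>\<^sup>2 / 2 * ?E (?d 1)
      + (\<theta> - 1 / 2) * \<tau>\<^sup>2 * (\<Sum>n=2..m. ?E (?d n)) = 1 / 2 * ?E (u 0)"
  proof -
    have "m \<ge> 1" using \<open>m \<ge> 2\<close> by simp
    then show ?thesis
    \<comment> \<open>Starting at 1 makes the base case the Euler balance alone, since the sum from
      2 is still empty; each further index adds one \<theta>-step.\<close>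
    proof (induction m rule: dec_induct)
      case base
      show ?case using energy[of 0] by (simp add: power2_eq_square algebra_simps)
    next
      case (step n)
      then show ?case
        using energy[of n] by (simp add: power2_eq_square algebra_simps)
    qed
  qed
  then show ?thesis
    by (simp only: grad)
qed

end
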